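(* For even $n=2k$, let $t_3^{\min}(n)$ denote the minimum possible number of triangles in a graph $G$ with $n$ vertices such that $d_G(x)+d_G(y)\ge n+1$ for all pairs of distinct vertices $x\ne y$ with $xy\notin E(G)$. Then, with $n$ ranging over the even positive integers, $$\lim_{n \rightarrow \infty}\frac{t_3^{\min}(n)}{n^2} = \frac{1}{4}.$$
   Context: Graphs are finite and simple; $d_G(x)$ denotes the degree of the vertex $x$ in $G$. The number of triangles is the number of subgraphs of $G$ isomorphic to $K_3$. *)

theory Defs
  imports Complex_Main "HOL-Library.Ramsey"
begin

text \<open>
  A graph is a pair of a vertex set and an edge set; edges are 2-element subsets of the vertex
  set, so there are neither loops nor multiple edges. \<open>[V]\<^bsup>r\<^esup>\<close> is the set of \<open>r\<close>-element
  subsets of \<open>V\<close>.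
\<close>

type_synonym 'a graph = "'a set \<times> 'a set set"

abbreviation verts :: "'a graph \<Rightarrow> 'a set" where
  "verts G \<equiv> fst G"

abbreviation edges :: "'a graph \<Rightarrow> 'a set set" where
  "edges G \<equiv> snd G"

definition simple_graph :: "'a graph \<Rightarrow> bool" where
  "simple_graph G \<longleftrightarrow> finite (verts G) \<and> edges G \<subseteq> [verts G]\<^bsup>2\<^esup>"

definition degree :: "'a graph \<Rightarrow> 'a \<Rightarrow> nat" where
  "degree G x = card {e \<in> edges G. x \<in> e}"

definition subgraph :: "'a graph \<Rightarrow> 'a graph \<Rightarrow> bool" where
  "subgraph H G \<longleftrightarrow> simple_graph H \<and> verts H \<subseteq> verts G \<and> edges H \<subseteq> edges G"

definition isomorphic :: "'a graph \<Rightarrow> 'b graph \<Rightarrow> bool" where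
  "isomorphic G H \<longleftrightarrow> (\<exists>f. bij_betw f (verts G) (verts H) \<and>
     (\<forall>x\<in>verts G. \<forall>y\<in>verts G. {x, y} \<in> edges G \<longleftrightarrow> {f x, f y} \<in> edges H))"

definition complete_graph :: "nat \<Rightarrow> nat graph" where
  "complete_graph r = ({..<r}, [{..<r}]\<^bsup>2\<^esup>)"

definition triangles :: "'a graph \<Rightarrow> nat" where
  "triangles G = card {H. subgraph H G \<and> isomorphic H (complete_graph 3)}"

definition ore_graph :: "nat \<Rightarrow> 'a graph \<Rightarrow> bool" where
  "ore_graph n G \<longleftrightarrow> simple_graph G \<and> card (verts G) = n \<and>
     (\<forall>x\<in>verts G. \<forall>y\<in>verts G. x \<noteq> y \<and> {x, y} \<notin> edges G \<longrightarrow>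
        degree G x + degree G y \<ge> n + 1)"

text \<open>
  Up to isomorphism, every finite graph has its vertices in \<^typ>\<open>nat\<close>. The minimum is taken over
  a nonempty set, see \<open>t3_min_attained\<close>.
\<close>

definition t3_min :: "nat \<Rightarrow> nat" where
  "t3_min n = (LEAST t. \<exists>G :: nat graph. ore_graph n G \<and> triangles G = t)"

lemma ore_graph_complete_graph: "ore_graph n (complete_graph n)"
  by (auto simp: ore_graph_def simple_graph_def complete_graph_def)

lemma t3_min_attained: "\<exists>G :: nat graph. ore_graph n G \<and> triangles G = t3_min n"
  unfolding t3_min_def by (rule LeastI_ex) (use ore_graph_complete_graph in blast)

lemma t3_min_le: "ore_graph n G \<Longrightarrow> t3_min n \<le> triangles G" for G :: "nat graph"
  unfolding t3_min_def by (rule Least_le) blast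

end

theory Submission
  imports Defs "HOL-Real_Asymp.Real_Asymp"
begin

text \<open>
  The minimum is at most \<open>k\<^sup>2\<close> because of a complete bipartite graph \<open>K\<^bsub>k,k\<^esub>\<close> with a maximum matching
  added inside each side: each of the at most \<open>k\<close> added edges lies in exactly \<open>k\<close> triangles, and
  there are no others (\<open>ore_extremal_graph\<close>, \<open>triangles_extremal_graph\<close>).

  For the lower bound \<open>k\<^sup>2 - o(k\<^sup>2)\<close>, let \<open>G\<close> satisfy the degree condition and have fewer than \<open>k\<^sup>2\<close>
  triangles. The vertices of degree at most \<open>k\<close> form a clique, which has only \<open>O(k\<^bsup>2/3\<^esup>)\<close> vertices
  since it contributes a cubic number of triangles. Counting degrees around a vertex of minimum
  degree then gives at least \<open>k\<^sup>2 + k - o(k)\<close> edges (\<open>deg_sum_ge\<close>). That such an excess of about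
  \<open>k\<close> edges over \<open>k\<^sup>2\<close> forces about \<open>k \<cdot> k\<close> triangles is an instance of the Lovasz--Simonovits
  theorem. A direct argument is possible here because almost all degrees exceed \<open>k\<close>.

  Averaging over edges yields an edge \<open>xy\<close> whose ends have degree above \<open>k\<close>, have boundedly
  many common neighbours and lie in \<open>O(k)\<close> triangles each. The neighbourhood of \<open>x\<close> and its
  complement, which is up to boundedly many vertices contained in the neighbourhood of \<open>y\<close>, form
  a cut \<open>A\<close>, \<open>B\<close> with only \<open>O(k)\<close> edges inside the parts (\<open>exists_sparse_cut\<close>).

  Given a sparse cut, count the triangles with exactly one edge inside a part. An edge inside \<open>A\<close>
  lies in \<open>|B|\<close> of them, minus losses due to missing pairs of the cut. A missing pair \<open>uw\<close>
  costs the sum of the inner degrees \<open>d\<close>, \<open>d'\<close> of its ends. If \<open>M\<close> is the size of the larger part,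
  then \<open>(M - d) (M - d') \<ge> 0\<close> bounds the cost by \<open>M + d d' / M\<close>, and the second terms sum to
  \<open>O(k)\<close> (\<open>tri_sum_cut_bound\<close>). So each missing pair costs about \<open>k\<close>. But each missing pair also
  forces one more inner edge, which gains about \<open>k\<close>. Hence missing pairs are harmless, and what
  remains is \<open>k\<close> times the excess of the number of edges over \<open>k\<^sup>2\<close> (\<open>tri_sum_lower_bound\<close>).
\<close>

section \<open>Counting edges and triangles by sums over vertices\<close>

text \<open>
  Everything is counted over ordered tuples of vertices, so that each count is an iterated sum of
  indicators: \<open>edge_sum V V\<close> is twice the number of edges, and \<open>tri_sum V V V\<close> is six
  times the number of triangles.
\<close>

locale adjacency =
  fixes V :: "'a set" and E :: "'a \<Rightarrow> 'a \<Rightarrow> bool"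
  assumes finite_V: "finite V"
    and E_sym: "E x y \<longleftrightarrow> E y x"
    and E_irrefl: "\<not> E x x"
begin

abbreviation a :: "'a \<Rightarrow> 'a \<Rightarrow> real" where
  "a x y \<equiv> of_bool (E x y)"

definition deg :: "'a \<Rightarrow> real" where
  "deg x = (\<Sum>y\<in>V. a x y)"

definition edge_sum :: "'a set \<Rightarrow> 'a set \<Rightarrow> real" where
  "edge_sum U W = (\<Sum>u\<in>U. \<Sum>w\<in>W. a u w)"

definition tri_sum :: "'a set \<Rightarrow> 'a set \<Rightarrow> 'a set \<Rightarrow> real" where
  "tri_sum U W X = (\<Sum>u\<in>U. \<Sum>w\<in>W. \<Sum>x\<in>X. a u w * a w x * a u x)"

lemma edge_sum_commute: "edge_sum U W = edge_sum W U"
  unfolding edge_sum_def by (subst sum.swap) (simp add: E_sym)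

lemma edge_sum_nonneg: "edge_sum U W \<ge> 0"
  unfolding edge_sum_def by (intro sum_nonneg) auto

lemma edge_sum_Un:
  assumes "finite U" "finite U'" "U \<inter> U' = {}"
  shows "edge_sum (U \<union> U') W = edge_sum U W + edge_sum U' W"
  unfolding edge_sum_def using assms by (simp add: sum.union_disjoint)

lemma edge_sum_mono:
  assumes "U \<subseteq> U'" "W \<subseteq> W'" "finite U'" "finite W'"
  shows "edge_sum U W \<le> edge_sum U' W'"
proof -
  have "edge_sum U W \<le> (\<Sum>u\<in>U. \<Sum>w\<in>W'. a u w)"
    unfolding edge_sum_def using assms by (intro sum_mono sum_mono2) auto
  also have "\<dots> \<le> edge_sum U' W'"
    unfolding edge_sum_def using assms by (intro sum_mono2) (auto intro: sum_nonneg)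
  finally show ?thesis .
qed

lemma edge_sum_le_card: "edge_sum U W \<le> real (card U) * real (card W)"
proof -
  have "edge_sum U W \<le> (\<Sum>u\<in>U. \<Sum>w\<in>W. 1)"
    unfolding edge_sum_def by (intro sum_mono) auto
  then show ?thesis by simp
qed

lemma tri_sum_swap12: "tri_sum U W X = tri_sum W U X"
  unfolding tri_sum_def
  by (subst sum.swap) (simp add: E_sym mult_ac)

lemma tri_sum_swap23: "tri_sum U W X = tri_sum U X W"
proof -
  have "tri_sum U W X = (\<Sum>u\<in>U. \<Sum>x\<in>X. \<Sum>w\<in>W. a u w * a w x * a u x)"
    unfolding tri_sum_def by (intro sum.cong refl sum.swap)
  also have "\<dots> = tri_sum U X W"
    unfolding tri_sum_def by (intro sum.cong refl) (use E_sym in \<open>auto\<close>)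
  finally show ?thesis .
qed

lemma tri_sum_nonneg: "tri_sum U W X \<ge> 0"
  unfolding tri_sum_def by (intro sum_nonneg) auto

lemma tri_sum_Un:
  assumes "finite U" "finite U'" "U \<inter> U' = {}"
  shows "tri_sum (U \<union> U') W X = tri_sum U W X + tri_sum U' W X"
  unfolding tri_sum_def using assms by (simp add: sum.union_disjoint)

lemma tri_sum_mono1:
  assumes "U \<subseteq> U'" "finite U'"
  shows "tri_sum U W X \<le> tri_sum U' W X"
  unfolding tri_sum_def using assms by (intro sum_mono2) (auto intro!: sum_nonneg)

lemma tri_sum_mono:
  assumes "U \<subseteq> V"
  shows "tri_sum U U U \<le> tri_sum V V V"
proof -
  have "tri_sum U U U \<le> tri_sum V U U"
    using assms finite_V by (rule tri_sum_mono1)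
  also have "\<dots> = tri_sum U V U" by (rule tri_sum_swap12)
  also have "\<dots> \<le> tri_sum V V U"
    using assms finite_V by (rule tri_sum_mono1)
  also have "\<dots> = tri_sum U V V"
    by (metis tri_sum_swap12 tri_sum_swap23)
  also have "\<dots> \<le> tri_sum V V V"
    using assms finite_V by (rule tri_sum_mono1)
  finally show ?thesis .
qed

section \<open>Triangles across a cut\<close>

text \<open>
  The ordered triples that meet both parts have two entries in one part and one in the other, and
  the single entry can be in any of three positions.
\<close>

lemma tri_sum_ge_cut:
  assumes "A \<union> B = V" "A \<inter> B = {}"
  shows "tri_sum V V V \<ge> 3 * (tri_sum A A B + tri_sum B B A)"
proof -
  have fin: "finite A" "finite B" using finite_V assms by auto
  have split: "tri_sum V W X = tri_sum A W X + tri_sum B W X" for W X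
    using tri_sum_Un[OF fin assms(2)] assms(1) by simp
  have split2: "tri_sum U V X = tri_sum U A X + tri_sum U B X" for U X
    using split tri_sum_swap12 by metis
  have split3: "tri_sum U W V = tri_sum U W A + tri_sum U W B" for U W
    using split2 tri_sum_swap23 by metis
  have "tri_sum A B A = tri_sum A A B" "tri_sum B A A = tri_sum A A B"
       "tri_sum A B B = tri_sum B B A" "tri_sum B A B = tri_sum B B A"
    using tri_sum_swap12 tri_sum_swap23 by metis+
  then show ?thesis
    using tri_sum_nonneg[of A A A] tri_sum_nonneg[of B B B]
    by (simp add: split split2 split3)
qed

text \<open>
  An inner edge \<open>uv\<close> together with \<open>w\<close> fails to be a triangle only if one of the pairs \<open>uw\<close>, \<open>vw\<close>
  is missing. By symmetry both failures have the same total, whence the factor 2.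
\<close>

lemma tri_sum_inner_edges:
  shows "tri_sum A A B \<ge> edge_sum A A * card B
           - 2 * (\<Sum>u\<in>A. \<Sum>w\<in>B. (1 - a u w) * (\<Sum>v\<in>A. a u v))"
proof -
  have "edge_sum A A * card B
           - 2 * (\<Sum>u\<in>A. \<Sum>w\<in>B. (1 - a u w) * (\<Sum>v\<in>A. a u v))
      = (\<Sum>u\<in>A. \<Sum>v\<in>A. \<Sum>w\<in>B. a u v * (1 - (1 - a u w) - (1 - a v w)))"
  proof -
    have 1: "(\<Sum>u\<in>A. \<Sum>w\<in>B. (1 - a u w) * (\<Sum>v\<in>A. a u v))
        = (\<Sum>u\<in>A. \<Sum>v\<in>A. \<Sum>w\<in>B. a u v * (1 - a u w))"
      by (subst sum.swap[of _ B A]) (simp add: sum_distrib_left mult.commute)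
    have 2: "(\<Sum>u\<in>A. \<Sum>v\<in>A. \<Sum>w\<in>B. a u v * (1 - a u w))
        = (\<Sum>u\<in>A. \<Sum>v\<in>A. \<Sum>w\<in>B. a u v * (1 - a v w))"
      by (subst sum.swap) (simp add: E_sym)
    have 3: "edge_sum A A * card B = (\<Sum>u\<in>A. \<Sum>v\<in>A. \<Sum>w\<in>B. a u v)"
      by (simp add: edge_sum_def sum_distrib_right sum_distrib_left mult.commute)
    show ?thesis
      unfolding mult_2 1 using 2 3
      by (simp add: right_diff_distrib sum_subtractf)
  qed
  also have "\<dots> \<le> tri_sum A A B"
    unfolding tri_sum_def by (intro sum_mono) auto
  finally show ?thesis .
qed

text \<open>
  The bound on the losses: a missing pair is charged \<open>M + d d' / M\<close>. Summed over all pairs of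
  \<open>A \<times> B\<close>, missing or not, the products \<open>d d'\<close> give the product of the two inner edge sums, which
  is of lower order once the parts are sparse.
\<close>

lemma tri_sum_cut_bound:
  fixes M :: real
  assumes AB: "A \<union> B = V" "A \<inter> B = {}"
    and M: "card A \<le> M" "card B \<le> M" "M > 0"
  shows "tri_sum V V V \<ge> 3 * (edge_sum A A * card B + edge_sum B B * card A)
           - 6 * (M * (real (card A) * real (card B) - edge_sum A B) + edge_sum A A * edge_sum B B / M)"
proof -
  define f where "f u = (\<Sum>v\<in>A. a u v)" for u
  define g where "g w = (\<Sum>v\<in>B. a w v)" for w
  have f: "0 \<le> f u" "f u \<le> M" for u
  proof -
    show "0 \<le> f u" unfolding f_def by (intro sum_nonneg) auto
    have "f u \<le> (\<Sum>v\<in>A. 1)" unfolding f_def by (intro sum_mono) auto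
    then show "f u \<le> M" using M by simp
  qed
  have g: "0 \<le> g u" "g u \<le> M" for u
  proof -
    show "0 \<le> g u" unfolding g_def by (intro sum_nonneg) auto
    have "g u \<le> (\<Sum>v\<in>B. 1)" unfolding g_def by (intro sum_mono) auto
    then show "g u \<le> M" using M by simp
  qed
  have key: "f u + g w \<le> M + f u * g w / M" for u w
  proof -
    have "0 \<le> (M - f u) * (M - g w)" using f g by (simp add: mult_nonneg_nonneg)
    then have "(f u + g w) * M \<le> M * M + f u * g w" by (simp add: algebra_simps)
    then show ?thesis using M by (simp add: field_simps)
  qed
  have "(\<Sum>u\<in>A. \<Sum>w\<in>B. (1 - a u w) * (f u + g w))
      \<le> (\<Sum>u\<in>A. \<Sum>w\<in>B. M * (1 - a u w) + f u * g w / M)"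
  proof (intro sum_mono)
    fix u w
    have "0 \<le> f u * g w / M" using f g M by simp
    then show "(1 - a u w) * (f u + g w) \<le> M * (1 - a u w) + f u * g w / M"
      using key[of u w] by (cases "E u w") auto
  qed
  also have "\<dots> = M * (real (card A) * real (card B) - edge_sum A B) + edge_sum A A * edge_sum B B / M"
  proof -
    have "(\<Sum>u\<in>A. \<Sum>w\<in>B. f u * g w / M) = edge_sum A A * edge_sum B B / M"
      unfolding edge_sum_def f_def[symmetric] g_def[symmetric]
      by (simp add: sum_product sum_divide_distrib)
    moreover have "(\<Sum>u\<in>A. \<Sum>w\<in>B. M * (1 - a u w)) = M * (real (card A) * real (card B) - edge_sum A B)"
      unfolding edge_sum_def by (simp add: sum_distrib_left[symmetric] sum_subtractf)
    ultimately show ?thesis by (simp add: sum.distrib)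
  qed
  finally have miss: "(\<Sum>u\<in>A. \<Sum>w\<in>B. (1 - a u w) * (f u + g w))
     \<le> M * (real (card A) * real (card B) - edge_sum A B) + edge_sum A A * edge_sum B B / M" .
  define R where "R = M * (real (card A) * real (card B) - edge_sum A B) + edge_sum A A * edge_sum B B / M"
  define F where "F = (\<Sum>u\<in>A. \<Sum>w\<in>B. (1 - a u w) * f u)"
  define G where "G = (\<Sum>w\<in>B. \<Sum>u\<in>A. (1 - a w u) * g w)"
  have "(\<Sum>u\<in>A. \<Sum>w\<in>B. (1 - a u w) * (f u + g w)) = F + G"
    unfolding F_def G_def
    by (subst (3) sum.swap) (simp add: E_sym distrib_left sum.distrib)
  with miss have "F + G \<le> R" by (simp add: R_def)
  moreover define P Q where "P = edge_sum A A * card B" and "Q = edge_sum B B * card A"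
  moreover have "P - 2 * F \<le> tri_sum A A B"
    using tri_sum_inner_edges[of A B] by (simp add: F_def f_def P_def)
  moreover have "Q - 2 * G \<le> tri_sum B B A"
    using tri_sum_inner_edges[of B A] by (simp add: G_def g_def Q_def)
  ultimately show ?thesis
    using tri_sum_ge_cut[OF AB] unfolding R_def[symmetric] P_def[symmetric] Q_def[symmetric]
    by argo
qed

text \<open>
  A clique on \<open>l\<close> vertices contains \<open>l (l - 1) (l - 2)\<close> ordered triangles; the cube makes it easy to
  solve for \<open>l\<close>.
\<close>

lemma tri_sum_clique:
  assumes "U \<subseteq> V" and clique: "\<And>x y. x \<in> U \<Longrightarrow> y \<in> U \<Longrightarrow> x \<noteq> y \<Longrightarrow> E x y"
    and "card U \<ge> 2"
  shows "(real (card U) - 2) ^ 3 \<le> tri_sum V V V"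
proof -
  have fin: "finite U" using assms finite_V finite_subset by blast
  define l where "l = real (card U)"
  have l: "l \<ge> 2" using assms(3) by (simp add: l_def)
  have 1: "(\<Sum>z\<in>U. a x y * a y z * a x z) \<ge> a x y * (l - 2)" if "x \<in> U" "y \<in> U" for x y
  proof -
    have "a x y * (l - 2) \<le> a x y * card (U - {x,y})"
      unfolding l_def using card_Diff_subset_Int[of U "{x,y}"] fin
        card_mono[of "{x,y}" "U \<inter> {x,y}"] card_insert_le_m1[of 2 "{y}" x]
      by (intro mult_left_mono) (auto simp: )
    also have "\<dots> = (\<Sum>z\<in>U - {x,y}. a x y * a y z * a x z)"
    proof (cases "x = y")
      case False
      then have "E x y" using that clique by blast
      moreover have "E y z" "E x z" if "z \<in> U - {x,y}" for z
        using that clique \<open>x \<in> U\<close> \<open>y \<in> U\<close> by auto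
      ultimately show ?thesis by simp
    qed (simp add: E_irrefl)
    also have "\<dots> \<le> (\<Sum>z\<in>U. a x y * a y z * a x z)"
      using fin by (intro sum_mono2) auto
    finally show ?thesis .
  qed
  have 2: "(\<Sum>y\<in>U. a x y * (l - 2)) \<ge> (l - 1) * (l - 2)" if "x \<in> U" for x
  proof -
    have "(l - 1) * (l - 2) \<le> (\<Sum>y\<in>U - {x}. a x y * (l - 2))"
    proof -
      have "(\<Sum>y\<in>U - {x}. a x y * (l - 2)) = (\<Sum>y\<in>U - {x}. l - 2)"
        using that clique by (intro sum.cong refl) auto
      moreover have "real (card (U - {x})) = l - 1"
        using that fin l by (simp add: l_def)
      ultimately show ?thesis by simp
    qed
    also have "\<dots> \<le> (\<Sum>y\<in>U. a x y * (l - 2))"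
      using fin l by (intro sum_mono2) auto
    finally show ?thesis .
  qed
  have "(l - 2) ^ 3 \<le> l * ((l - 1) * (l - 2))"
    unfolding power3_eq_cube mult.assoc using l by (intro mult_mono) auto
  also have "\<dots> = (\<Sum>x\<in>U. (l - 1) * (l - 2))" by (simp add: l_def)
  also have "\<dots> \<le> (\<Sum>x\<in>U. \<Sum>y\<in>U. a x y * (l - 2))"
    by (intro sum_mono 2)
  also have "\<dots> \<le> tri_sum U U U"
    unfolding tri_sum_def by (intro sum_mono 1)
  also have "\<dots> \<le> tri_sum V V V" using assms(1) by (rule tri_sum_mono)
  finally show ?thesis by (simp add: l_def)
qed

end

section \<open>Degrees under the degree sum condition\<close>

locale ore_adjacency = adjacency +
  fixes k :: nat
  assumes card_V: "card V = 2 * k"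
    and ore: "\<And>x y. x \<in> V \<Longrightarrow> y \<in> V \<Longrightarrow> x \<noteq> y \<Longrightarrow> \<not> E x y \<Longrightarrow> 2 * real k + 1 \<le> deg x + deg y"
begin

definition low :: "'a set" where
  "low = {x \<in> V. deg x \<le> k}"

lemma low_subset: "low \<subseteq> V" by (auto simp: low_def)

lemma finite_low: "finite low" using low_subset finite_V finite_subset by blast

lemma low_clique: "x \<in> low \<Longrightarrow> y \<in> low \<Longrightarrow> x \<noteq> y \<Longrightarrow> E x y"
  using ore[of x y] by (force simp: low_def)

lemma deg_eq_card: "deg x = real (card {y \<in> V. E x y})"
  unfolding deg_def using finite_V by (simp add: Int_def)

lemma deg_high: "x \<in> V - low \<Longrightarrow> deg x \<ge> real k + 1"
  unfolding low_def deg_eq_card by (auto simp: not_le)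

lemma edge_sum_V: "edge_sum U V = (\<Sum>u\<in>U. deg u)"
  by (simp add: edge_sum_def deg_def)

text \<open>
  If \<open>v\<close> has the minimum degree \<open>k - s\<close> with \<open>s \<ge> 0\<close>, then its \<open>k + s - 1\<close> non-neighbours have degree at
  least \<open>k + 1 + s\<close>. This surplus makes up for the deficit of at most \<open>s + 1\<close> at each of the few
  vertices of \<open>low\<close>, up to 1 for each of them.
\<close>

lemma deg_sum_ge:
  assumes "card low \<le> k" "k \<ge> 1"
  shows "2 * real k ^ 2 + 2 * k - card low \<le> edge_sum V V"
proof (cases "low = {}")
  case True
  have "edge_sum V V \<ge> (\<Sum>u\<in>V. real k + 1)"
    unfolding edge_sum_V using deg_high True by (intro sum_mono) auto
  then show ?thesis using True card_V by (simp add: power2_eq_square algebra_simps)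
next
  case False
  obtain v where v: "v \<in> low" and vmin: "\<And>u. u \<in> low \<Longrightarrow> deg v \<le> deg u"
    using False finite_low by (metis arg_min_if_finite(1) arg_min_least)
  define N where "N = {y \<in> V. E v y}"
  define K where "K = V - N - {v}"
  define s where "s = real k - deg v"
  define l where "l = real (card low)"
  have s: "s \<ge> 0" using v by (simp add: s_def low_def)
  have N: "N \<subseteq> V" "finite N" "v \<in> V" "v \<notin> N"
    using finite_V v E_irrefl by (auto simp: N_def low_def)
  have cN: "real (card N) = k - s" unfolding N_def s_def deg_eq_card by simp
  have "card N + 1 + card K = card V"
  proof -
    have fK: "finite K" and disj: "N \<inter> K = {}" "v \<notin> N \<union> K"
      using N finite_V by (auto simp: K_def)
    have "V = insert v (N \<union> K)" using N by (auto simp: K_def)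
    then show ?thesis
      using card_insert_disjoint[of "N \<union> K" v] card_Un_disjoint[OF N(2) fK disj(1)] disj fK N
      by simp
  qed
  then have cK: "real (card K) = k + s - 1"
    using cN card_V by linarith
  have KL: "K \<inter> low = {}"
    using low_clique v by (auto simp: K_def N_def low_def)
  have cR: "real (card (V - low - K)) = k + 1 - s - l"
  proof -
    have "card V = card (V - low - K) + card low + card K"
    proof -
      have fK: "finite K" and sub: "low \<union> K \<subseteq> V"
        using finite_V low_subset by (auto simp: K_def)
      have "V - low - K = V - (low \<union> K)" by blast
      then show ?thesis
        using card_Diff_subset[of "low \<union> K" V] card_mono[OF finite_V sub] sub fK finite_low
          card_Un_disjoint[OF finite_low fK] KL by (simp add: Int_commute)
    qed
    then show ?thesis using cK card_V unfolding l_def by linarith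
  qed
  have "(\<Sum>u\<in>K. real k + 1 + s) \<le> (\<Sum>u\<in>K. deg u)"
  proof (intro sum_mono)
    fix u assume "u \<in> K"
    then have "2 * real k + 1 \<le> deg v + deg u"
      using ore[of v u] N by (auto simp: K_def N_def)
    then show "real k + 1 + s \<le> deg u" by (simp add: s_def)
  qed
  moreover have "(\<Sum>u\<in>low. real k - s) \<le> (\<Sum>u\<in>low. deg u)"
    using vmin by (intro sum_mono) (auto simp: s_def)
  moreover have "(\<Sum>u\<in>V - low - K. real k + 1) \<le> (\<Sum>u\<in>V - low - K. deg u)"
    using deg_high by (intro sum_mono) auto
  moreover have "edge_sum V V = (\<Sum>u\<in>K. deg u) + (\<Sum>u\<in>low. deg u) + (\<Sum>u\<in>V - low - K. deg u)"
  proof -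
    have "(\<Sum>u\<in>V. deg u) = (\<Sum>u\<in>V - low. deg u) + (\<Sum>u\<in>low. deg u)"
      using finite_V low_subset by (rule sum.subset_diff[rotated])
    also have "(\<Sum>u\<in>V - low. deg u) = (\<Sum>u\<in>V - low - K. deg u) + (\<Sum>u\<in>K. deg u)"
      using finite_V KL by (intro sum.subset_diff) (auto simp: K_def)
    finally show ?thesis by (simp add: edge_sum_V)
  qed
  ultimately have D: "edge_sum V V \<ge> (k + s - 1) * (real k + 1 + s) + l * (real k - s)
      + (k + 1 - s - l) * (real k + 1)"
    by (simp add: cK cR l_def)
  \<comment> \<open>For \<open>0 < s < 1\<close> and \<open>l = k\<close> the second factor would be negative, but \<open>s\<close> is an integer.\<close>
  have "0 \<le> s * (k + s - 1 - l)"
  proof (cases "s \<ge> 1")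
    case True
    then show ?thesis using s assms unfolding l_def by (intro mult_nonneg_nonneg) auto
  next
    case False
    have "s = real_of_int (int k - int (card N))" using cN by simp
    moreover have "int k - int (card N) < 1 \<and> 0 \<le> int k - int (card N)"
      using s False calculation by simp
    ultimately have "s = 0" by simp
    then show ?thesis by simp
  qed
  with D show ?thesis by (simp add: algebra_simps power2_eq_square l_def)
qed

text \<open>
  As \<open>low\<close> is small and its vertices have degree at most \<open>k\<close>, a constant fraction of all edges
  avoids it. Averaging over these edges alone thus costs only a constant factor.
\<close>

lemma high_edge_sum_gt:
  assumes "2 * card low \<le> k" "k \<ge> 1"
  shows "real k ^ 2 < edge_sum (V - low) (V - low)"
proof -
  define l where "l = real (card low)"
  have "card (V - low) + card low = card V"
    using card_Diff_subset[OF finite_low low_subset] card_mono[OF finite_V low_subset] by linarith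
  then have c: "real (card (V - low)) = 2 * k - l" using card_V unfolding l_def by linarith
  have "(\<Sum>u\<in>V - low. real k + 1) \<le> edge_sum (V - low) V"
    unfolding edge_sum_V using deg_high by (intro sum_mono) auto
  moreover have "edge_sum V (V - low) = edge_sum (V - low) (V - low) + edge_sum low (V - low)"
  proof -
    have "V - low \<union> low = V" "(V - low) \<inter> low = {}" using low_subset by auto
    then show ?thesis
      using edge_sum_Un[of "V - low" low "V - low"] finite_V finite_low by simp
  qed
  moreover have "edge_sum low (V - low) \<le> edge_sum low V"
    using finite_V finite_low by (intro edge_sum_mono) auto
  moreover have "edge_sum low V \<le> (\<Sum>u\<in>low. real k)"
    unfolding edge_sum_V by (intro sum_mono) (auto simp: low_def)
  ultimately have "(2 * k - l) * (real k + 1) - l * k \<le> edge_sum (V - low) (V - low)"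
    using edge_sum_commute[of V "V - low"] c by (simp add: l_def)
  moreover have "2 * l * k \<le> real k * real k"
  proof -
    have "2 * l \<le> k" using assms unfolding l_def by linarith
    then have "2 * l * real k \<le> real k * real k" by (rule mult_right_mono) simp
    then show ?thesis by simp
  qed
  moreover have "2 * l \<le> k" "real k > 0" using assms unfolding l_def by auto
  moreover have "(real (2 * k) - l) * (real k + 1) - l * k = 2 * (real k * real k) + 2 * real k - 2 * l * k - l"
    by (simp add: algebra_simps)
  ultimately show ?thesis unfolding power2_eq_square by argo
qed

section \<open>A cut with few edges inside its parts\<close>

definition codeg :: "'a \<Rightarrow> 'a \<Rightarrow> real" where
  "codeg x y = (\<Sum>z\<in>V. a y z * a x z)"

definition tri_at :: "'a \<Rightarrow> real" where
  "tri_at x = (\<Sum>y\<in>V. \<Sum>z\<in>V. a x y * a y z * a x z)"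

text \<open>
  The triangles through \<open>x\<close> are the edges inside the neighbourhood of \<open>x\<close>. So a vertex in few
  triangles has a sparse neighbourhood.
\<close>

lemma tri_at_eq: "tri_at x = edge_sum {y \<in> V. E x y} {y \<in> V. E x y}"
proof -
  have "tri_at x = (\<Sum>y\<in>V. if E x y then (\<Sum>z\<in>V. if E x z then a y z else 0) else 0)"
    unfolding tri_at_def by (intro sum.cong refl) (auto intro!: sum.cong)
  also have "\<dots> = edge_sum {y \<in> V. E x y} {y \<in> V. E x y}"
    unfolding edge_sum_def
    by (simp only: sum.inter_filter[OF finite_V, symmetric])
  finally show ?thesis .
qed

text \<open>
  The weight \<open>k \<cdot> codeg x y + tri_at x + tri_at y\<close> balances the quantities that have to be small. Its
  sum over all ordered edges is at most \<open>5 k\<close> times \<open>tri_sum V V V\<close>, hence at most \<open>30 k\<^sup>3\<close>, while there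
  are more than \<open>k\<^sup>2\<close> ordered edges outside \<open>low\<close>. So some such edge has weight less than \<open>30 k\<close>.
\<close>

lemma exists_good_edge:
  assumes "2 * card low \<le> k" "k \<ge> 1" and tri: "tri_sum V V V \<le> 6 * real k ^ 2"
  shows "\<exists>x\<in>V - low. \<exists>y\<in>V - low. E x y \<and> codeg x y \<le> 30 \<and> tri_at x \<le> 30 * k \<and> tri_at y \<le> 30 * k"
proof (rule ccontr)
  assume contr: "\<not> ?thesis"
  define f where "f x y = k * codeg x y + tri_at x + tri_at y" for x y
  have nn: "codeg x y \<ge> 0" "tri_at x \<ge> 0" for x y
    unfolding codeg_def tri_at_def by (auto intro!: sum_nonneg)
  have nf: "f x y \<ge> 0" for x y unfolding f_def using nn by simp
  have f: "f x y \<ge> 30 * k" if "x \<in> V - low" "y \<in> V - low" "E x y" for x y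
  proof (rule ccontr)
    assume "\<not> ?thesis"
    then have *: "f x y < 30 * k" by simp
    have "tri_at x \<le> 30 * k" "tri_at y \<le> 30 * k" "k * codeg x y \<le> k * 30"
    proof -
      have "0 \<le> k * codeg x y" using nn by simp
      then show "tri_at x \<le> 30 * k" "tri_at y \<le> 30 * k" "k * codeg x y \<le> k * 30"
        using * nn(2)[of x] nn(2)[of y] unfolding f_def by linarith+
    qed
    moreover from this have "codeg x y \<le> 30" using \<open>k \<ge> 1\<close> by simp
    ultimately show False using that contr by blast
  qed
  have S: "(\<Sum>x\<in>V. tri_at x) = tri_sum V V V"
    by (simp add: tri_at_def tri_sum_def)
  have Sc: "(\<Sum>x\<in>V. \<Sum>y\<in>V. a x y * codeg x y) = tri_sum V V V"
    by (simp add: codeg_def tri_sum_def sum_distrib_left mult.assoc)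
  have "30 * k * k ^ 2 < 30 * k * edge_sum (V - low) (V - low)"
    using high_edge_sum_gt[OF assms(1,2)] assms(2) by simp
  also have "\<dots> \<le> (\<Sum>x\<in>V - low. \<Sum>y\<in>V - low. a x y * f x y)"
    unfolding edge_sum_def sum_distrib_left using f by (intro sum_mono) auto
  also have "\<dots> \<le> (\<Sum>x\<in>V. \<Sum>y\<in>V - low. a x y * f x y)"
    using finite_V nf by (intro sum_mono2) (auto intro!: sum_nonneg)
  also have "\<dots> \<le> (\<Sum>x\<in>V. \<Sum>y\<in>V. a x y * f x y)"
    using finite_V nf by (intro sum_mono sum_mono2) (auto intro!: sum_nonneg)
  also have "\<dots> = k * (\<Sum>x\<in>V. \<Sum>y\<in>V. a x y * codeg x y)
      + (\<Sum>x\<in>V. \<Sum>y\<in>V. a x y * tri_at x) + (\<Sum>x\<in>V. \<Sum>y\<in>V. a x y * tri_at y)"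
    by (simp add: f_def distrib_left sum.distrib sum_distrib_left mult_ac)
  also have "(\<Sum>x\<in>V. \<Sum>y\<in>V. a x y * tri_at y) = (\<Sum>x\<in>V. \<Sum>y\<in>V. a x y * tri_at x)"
    by (subst sum.swap) (simp add: E_sym)
  also have "(\<Sum>x\<in>V. \<Sum>y\<in>V. a x y * tri_at x) \<le> (\<Sum>x\<in>V. 2 * k * tri_at x)"
  proof (intro sum_mono)
    fix x
    have "(\<Sum>y\<in>V. a x y * tri_at x) \<le> (\<Sum>y\<in>V. tri_at x)"
      using nn by (intro sum_mono) auto
    then show "(\<Sum>y\<in>V. a x y * tri_at x) \<le> 2 * k * tri_at x" using card_V by simp
  qed
  also have "\<dots> = 2 * k * tri_sum V V V" by (simp add: S sum_distrib_left[symmetric])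
  finally have "30 * k * k ^ 2 < 5 * k * tri_sum V V V"
    unfolding Sc by simp
  also have "\<dots> \<le> 5 * k * (6 * real k ^ 2)"
    using tri by (intro mult_left_mono) auto
  finally show False by simp
qed

text \<open>
  The ends of a good edge have together at least \<open>2 k + 2\<close> neighbours, of which at most 30 are
  counted twice. So the set \<open>R\<close> of vertices adjacent to neither end has at most 28 elements. With
  \<open>A\<close> the neighbourhood of \<open>x\<close>, the other part is contained in the neighbourhood of \<open>y\<close> and \<open>R\<close>, and
  \<open>R\<close> adds at most \<open>2 \<cdot> 28 \<cdot> 2 k = 112 k\<close> to the edge sum.
\<close>

lemma exists_sparse_cut:
  assumes "2 * card low \<le> k" "k \<ge> 1" and "tri_sum V V V \<le> 6 * real k ^ 2"
  shows "\<exists>A B. A \<union> B = V \<and> A \<inter> B = {} \<and> edge_sum A A \<le> 30 * k \<and> edge_sum B B \<le> 142 * k"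
proof -
  obtain x y where xy: "x \<in> V - low" "y \<in> V - low" and c: "codeg x y \<le> 30"
    and t: "tri_at x \<le> 30 * k" "tri_at y \<le> 30 * k"
    using exists_good_edge[OF assms] by blast
  define N where "N z = {u \<in> V. E z u}" for z
  define R where "R = V - N x - N y"
  have N: "N z \<subseteq> V" "finite (N z)" for z using finite_V by (auto simp: N_def)
  have cN: "real (card (N z)) = deg z" for z by (simp add: N_def deg_eq_card)
  have "codeg x y = (\<Sum>z\<in>V. of_bool (z \<in> N x \<inter> N y))"
    unfolding codeg_def by (intro sum.cong) (auto simp: N_def)
  also have "\<dots> = card (N x \<inter> N y)"
  proof -
    have "V \<inter> {z. z \<in> N x \<inter> N y} = N x \<inter> N y" using N(1) by auto
    then show ?thesis using finite_V by (simp add: sum_of_bool_eq)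
  qed
  finally have "card (N x \<inter> N y) \<le> 30" using c by simp
  moreover have "card (N x) + card (N y) = card (N x \<union> N y) + card (N x \<inter> N y)"
    using N by (intro card_Un_Int)
  moreover have "card (N x) \<ge> k + 1" "card (N y) \<ge> k + 1"
    using deg_high[OF xy(1)] deg_high[OF xy(2)] unfolding cN[symmetric] by linarith+
  moreover have "card R + card (N x \<union> N y) = card V"
  proof -
    have "R = V - (N x \<union> N y)" by (auto simp: R_def)
    moreover have "N x \<union> N y \<subseteq> V" "finite (N x \<union> N y)" using N by auto
    ultimately show ?thesis
      using card_Diff_subset[of "N x \<union> N y" V] card_mono[of V "N x \<union> N y"] finite_V by simp
  qed
  ultimately have R: "card R \<le> 28" using card_V by linarith
  define B where "B = V - N x"
  have finR: "finite R" using finite_V by (simp add: R_def)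
  have "edge_sum B B \<le> edge_sum (N y \<union> R) (N y \<union> R)"
    using N finR by (intro edge_sum_mono) (auto simp: B_def R_def)
  also have "\<dots> \<le> edge_sum (N y) (N y) + edge_sum R V + edge_sum V R"
  proof -
    have disj: "N y \<inter> R = {}" by (auto simp: R_def)
    have RV: "R \<subseteq> V" by (auto simp: R_def)
    have "edge_sum (N y \<union> R) (N y \<union> R) = edge_sum (N y) (N y \<union> R) + edge_sum R (N y \<union> R)"
      using N finR disj by (intro edge_sum_Un)
    also have "edge_sum (N y) (N y \<union> R) = edge_sum (N y) (N y) + edge_sum R (N y)"
      using edge_sum_Un[OF N(2) finR disj] edge_sum_commute by metis
    also have "edge_sum R (N y) = edge_sum (N y) R" by (rule edge_sum_commute)
    also have "\<dots> \<le> edge_sum V R" using N finite_V finR by (intro edge_sum_mono) auto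
    also have "edge_sum R (N y \<union> R) \<le> edge_sum R V"
      using N finite_V finR RV by (intro edge_sum_mono) auto
    finally show ?thesis by simp
  qed
  also have "edge_sum (N y) (N y) \<le> 30 * k" using t(2) by (simp add: tri_at_eq N_def)
  also have "edge_sum V R = edge_sum R V" by (rule edge_sum_commute)
  also have "edge_sum R V \<le> 28 * (2 * real k)"
  proof -
    have "edge_sum R V \<le> real (card R) * real (card V)" by (rule edge_sum_le_card)
    also have "\<dots> \<le> 28 * real (card V)" using R by (intro mult_right_mono) auto
    finally show ?thesis by (simp add: card_V)
  qed
  finally have "edge_sum B B \<le> 142 * k" by simp
  moreover have "edge_sum (N x) (N x) \<le> 30 * k" using t(1) by (simp add: tri_at_eq N_def)
  moreover have "N x \<union> B = V" "N x \<inter> B = {}" using N by (auto simp: B_def)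
  ultimately show ?thesis by blast
qed

section \<open>The lower bound\<close>

text \<open>
  Let the parts of a sparse cut have sizes \<open>k + \<alpha>\<close> and \<open>k - \<alpha>\<close>, and let \<open>D\<close> be twice the excess of the
  number of edges over \<open>k\<^sup>2\<close>. Counting edges, the inner edge sums \<open>p + q\<close> equal \<open>D + 2 \<alpha>\<^sup>2\<close> plus
  twice the number of missing pairs. Substituted into the cut bound, the missing pairs
  cancel up to terms with a factor \<open>\<alpha>\<close>, and \<open>p q / M\<close> is \<open>O(k)\<close>. The imbalance \<open>\<alpha>\<close> itself
  gains \<open>2 k \<alpha>\<^sup>2\<close> and loses \<open>O(k) \<alpha>\<close>, which is at worst \<open>O(k)\<close> by completing the square.
\<close>

lemma tri_sum_lower_bound:
  assumes "2 * card low \<le> k" "k \<ge> 1" and "tri_sum V V V \<le> 6 * real k ^ 2"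
  shows "6 * real k ^ 2 - 3 * card low * k - 69936 * k \<le> tri_sum V V V"
proof -
  obtain A B where AB: "A \<union> B = V" "A \<inter> B = {}"
    and sp: "edge_sum A A \<le> 30 * k" "edge_sum B B \<le> 142 * k"
    using exists_sparse_cut[OF assms] by blast
  have fin: "finite A" "finite B" using AB finite_V by auto
  define \<alpha> where "\<alpha> = \<bar>real (card A) - k\<bar>"
  define p q X where "p = edge_sum A A" and "q = edge_sum B B" and "X = edge_sum A B"
  define D where "D = edge_sum V V - 2 * real k ^ 2"
  define r s where "r = real (card A)" and "s = real (card B)"
  define K where "K = real k"
  have rs: "r + s = 2 * K"
    using card_Un_disjoint[OF fin AB(2)] AB(1) card_V by (simp add: r_def s_def K_def)
  have K: "K \<ge> 1" using assms by (simp add: K_def)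
  have \<alpha>: "\<alpha> \<ge> 0" "r \<le> K + \<alpha>" "s \<le> K + \<alpha>" "r \<ge> K - \<alpha>" "s \<ge> K - \<alpha>"
    using rs unfolding \<alpha>_def r_def[symmetric] K_def[symmetric] by auto
  have rs2: "r * s = K^2 - \<alpha>^2"
  proof -
    have "s = 2 * K - r" using rs by simp
    then have "r * s = r * (2 * K - r)" by simp
    also have "\<dots> = K^2 - \<alpha>^2"
      unfolding \<alpha>_def r_def[symmetric] K_def[symmetric] power2_abs
      by (simp add: power2_eq_square algebra_simps)
    finally show ?thesis .
  qed
  have pq: "0 \<le> p" "p \<le> 30 * K" "0 \<le> q" "q \<le> 142 * K"
    using sp edge_sum_nonneg by (auto simp: p_def q_def K_def)
  have D: "2 * K - card low \<le> D" "D \<ge> 0"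
    using deg_sum_ge assms by (auto simp: D_def K_def)
  have "edge_sum V V = edge_sum A V + edge_sum B V"
    using edge_sum_Un[OF fin AB(2)] AB(1) by simp
  also have "edge_sum A V = p + X"
    using edge_sum_Un[OF fin AB(2), of A] AB(1) edge_sum_commute by (metis p_def X_def)
  also have "edge_sum B V = X + q"
    using edge_sum_Un[OF fin AB(2), of B] AB(1) edge_sum_commute by (metis q_def X_def)
  finally have X: "2 * (r * s - X) = p + q - D - 2 * \<alpha>^2"
    unfolding rs2 by (simp add: D_def K_def)
  have "tri_sum V V V \<ge> 3 * (p * s + q * r) - 6 * ((K + \<alpha>) * (r * s - X) + p * q / (K + \<alpha>))"
    using tri_sum_cut_bound[OF AB, of "K + \<alpha>"] \<alpha> K
    by (simp add: p_def q_def X_def r_def s_def)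
  moreover have "p * s + q * r \<ge> (p + q) * (K - \<alpha>)"
    unfolding distrib_right using pq \<alpha> by (intro add_mono mult_left_mono) auto
  moreover have "6 * ((K + \<alpha>) * (r * s - X)) = 3 * ((K + \<alpha>) * (p + q - D - 2 * \<alpha>^2))"
    unfolding X[symmetric] by simp
  moreover have "p * q / (K + \<alpha>) \<le> 4260 * K"
  proof -
    have "p * q / (K + \<alpha>) \<le> p * q / K"
      using pq \<alpha> K by (intro divide_left_mono) auto
    also have "\<dots> \<le> (30 * K) * (142 * K) / K"
      using pq K by (intro divide_right_mono mult_mono) auto
    finally show ?thesis using K by simp
  qed
  moreover have "(p + q) * (K - \<alpha>) - (K + \<alpha>) * (p + q - D - 2 * \<alpha>^2)
      = K * D + \<alpha> * D + 2 * \<alpha>^3 + 2 * (K * \<alpha>^2 - \<alpha> * (p + q))"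
    by (simp add: algebra_simps power2_eq_square power3_eq_cube)
  moreover have "\<alpha> * D \<ge> 0" "\<alpha>^3 \<ge> 0" using \<alpha> D by auto
  \<comment> \<open>\<open>p + q \<le> 172 K\<close>, and the minimum of \<open>\<alpha>\<^sup>2 - 172 \<alpha>\<close> is \<open>- 86\<^sup>2 = - 7396\<close>.\<close>
  moreover have "K * \<alpha>^2 - \<alpha> * (p + q) \<ge> - 7396 * K"
  proof -
    have "\<alpha> * (p + q) \<le> \<alpha> * (172 * K)" using \<alpha> pq by (intro mult_left_mono) auto
    moreover have "0 \<le> K * (\<alpha> - 86)^2" using K by simp
    ultimately show ?thesis by (simp add: power2_eq_square algebra_simps)
  qed
  moreover have "K * D \<ge> K * (2 * K - card low)" using D K by (intro mult_left_mono) auto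
  ultimately have "3 * (K * (2 * K - card low) - 14792 * K) - 25560 * K \<le> tri_sum V V V"
    by argo
  then show ?thesis by (simp add: K_def algebra_simps power2_eq_square)
qed

end

section \<open>Triangles of a graph as vertex sets\<close>

definition triangle_sets :: "'a graph \<Rightarrow> 'a set set" where
  "triangle_sets G = {T. T \<subseteq> verts G \<and> card T = 3 \<and> [T]\<^bsup>2\<^esup> \<subseteq> edges G}"

lemma nsets2_eq: "e \<in> [T]\<^bsup>2\<^esup> \<longleftrightarrow> (\<exists>x\<in>T. \<exists>y\<in>T. x \<noteq> y \<and> e = {x, y})"
  by (auto simp: nsets_def card_2_iff)

text \<open>
  The isomorphism type fixes the number of vertices, and simplicity excludes edges other than
  pairs of vertices; so a complete subgraph is determined by its vertex set.
\<close>

lemma isomorphic_complete_graph_iff: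
  assumes "simple_graph H"
  shows "isomorphic H (complete_graph r) \<longleftrightarrow> card (verts H) = r \<and> edges H = [verts H]\<^bsup>2\<^esup>"
proof
  assume "isomorphic H (complete_graph r)"
  then obtain f where f: "bij_betw f (verts H) {..<r}"
    and iso: "\<And>x y. x \<in> verts H \<Longrightarrow> y \<in> verts H \<Longrightarrow>
                {x, y} \<in> edges H \<longleftrightarrow> {f x, f y} \<in> [{..<r}]\<^bsup>2\<^esup>"
    unfolding isomorphic_def complete_graph_def by auto
  have "[verts H]\<^bsup>2\<^esup> \<subseteq> edges H"
  proof
    fix e assume "e \<in> [verts H]\<^bsup>2\<^esup>"
    then obtain x y where xy: "x \<in> verts H" "y \<in> verts H" "x \<noteq> y" "e = {x, y}"
      unfolding nsets2_eq by blast
    then have "f x \<noteq> f y" "f x \<in> {..<r}" "f y \<in> {..<r}"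
      using f by (auto simp: bij_betw_def inj_on_def)
    then have "{f x, f y} \<in> [{..<r}]\<^bsup>2\<^esup>" unfolding nsets2_eq by blast
    then show "e \<in> edges H" using iso xy by simp
  qed
  then show "card (verts H) = r \<and> edges H = [verts H]\<^bsup>2\<^esup>"
    using assms bij_betw_same_card[OF f] by (auto simp: simple_graph_def)
next
  assume H: "card (verts H) = r \<and> edges H = [verts H]\<^bsup>2\<^esup>"
  then obtain f where f: "bij_betw f (verts H) {..<r}"
    using assms ex_bij_betw_finite_nat[of "verts H"]
    by (auto simp: simple_graph_def atLeast0LessThan)
  have "{x, y} \<in> [verts H]\<^bsup>2\<^esup> \<longleftrightarrow> {f x, f y} \<in> [{..<r}]\<^bsup>2\<^esup>"
    if "x \<in> verts H" "y \<in> verts H" for x y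
  proof -
    have "f x = f y \<longleftrightarrow> x = y" "f x \<in> {..<r}" "f y \<in> {..<r}"
      using f that by (auto simp: bij_betw_def inj_on_def)
    then show ?thesis
      using that by (simp add: nsets_def) (auto simp: card_insert_if)
  qed
  then show "isomorphic H (complete_graph r)"
    using f H unfolding isomorphic_def complete_graph_def by auto
qed

lemma triangles_eq_card_triangle_sets: "triangles G = card (triangle_sets G)"
proof -
  have "bij_betw verts {H. subgraph H G \<and> isomorphic H (complete_graph 3)} (triangle_sets G)"
  proof (rule bij_betw_byWitness[where f' = "\<lambda>T. (T, [T]\<^bsup>2\<^esup>)"])
    show "\<forall>H\<in>{H. subgraph H G \<and> isomorphic H (complete_graph 3)}.
            (verts H, [verts H]\<^bsup>2\<^esup>) = H"
      using isomorphic_complete_graph_iff by (fastforce simp: subgraph_def prod_eq_iff)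
    show "verts ` {H. subgraph H G \<and> isomorphic H (complete_graph 3)} \<subseteq> triangle_sets G"
      using isomorphic_complete_graph_iff by (fastforce simp: subgraph_def triangle_sets_def)
    show "(\<lambda>T. (T, [T]\<^bsup>2\<^esup>)) ` triangle_sets G
            \<subseteq> {H. subgraph H G \<and> isomorphic H (complete_graph 3)}"
    proof clarify
      fix T assume T: "T \<in> triangle_sets G"
      then have "finite T" by (intro card_ge_0_finite) (simp add: triangle_sets_def)
      then have "simple_graph (T, [T]\<^bsup>2\<^esup>)" by (simp add: simple_graph_def)
      then show "subgraph (T, [T]\<^bsup>2\<^esup>) G \<and> isomorphic (T, [T]\<^bsup>2\<^esup>) (complete_graph 3)"
        using T isomorphic_complete_graph_iff[of "(T, [T]\<^bsup>2\<^esup>)" 3]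
        by (simp add: subgraph_def triangle_sets_def)
    qed
  qed simp
  then show ?thesis unfolding triangles_def by (rule bij_betw_same_card)
qed

lemma card_ordered_triples_le:
  assumes "card T = 3"
  shows "finite {(x, y, z). {x, y, z} = T} \<and> card {(x, y, z). {x, y, z} = T} \<le> 6"
proof -
  obtain p q r where T: "T = {p, q, r}" "p \<noteq> q" "p \<noteq> r" "q \<noteq> r"
    using assms by (auto simp: card_3_iff)
  let ?P = "[(p,q,r), (p,r,q), (q,p,r), (q,r,p), (r,p,q), (r,q,p)]"
  have "{(x, y, z). {x, y, z} = T} \<subseteq> set ?P"
  proof
    fix t assume "t \<in> {(x, y, z). {x, y, z} = T}"
    then obtain x y z where t: "t = (x, y, z)" and *: "{x, y, z} = T" by auto
    then have "x \<in> {p,q,r}" "y \<in> {p,q,r}" "z \<in> {p,q,r}" "p \<in> {x,y,z}" "q \<in> {x,y,z}" "r \<in> {x,y,z}"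
      using T(1) by blast+
    then show "t \<in> set ?P" using T(2-4) t by auto
  qed
  then have "finite {(x, y, z). {x, y, z} = T}" "card {(x, y, z). {x, y, z} = T} \<le> card (set ?P)"
    by (auto intro: finite_subset card_mono)
  then show ?thesis using card_length[of ?P] by simp
qed

abbreviation adj :: "'a graph \<Rightarrow> 'a \<Rightarrow> 'a \<Rightarrow> bool" where
  "adj G x y \<equiv> {x, y} \<in> edges G"

lemma simple_graph_not_loop: "simple_graph G \<Longrightarrow> \<not> adj G x x"
  by (auto simp: simple_graph_def nsets_def)

lemma adjacency_simple_graph: "simple_graph G \<Longrightarrow> adjacency (verts G) (adj G)"
  using simple_graph_not_loop[of G]
  by unfold_locales (auto simp: simple_graph_def insert_commute)

lemma degree_eq_card_adj:
  assumes "simple_graph G"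
  shows "degree G x = card {y \<in> verts G. adj G x y}"
proof -
  have "{e \<in> edges G. x \<in> e} = (\<lambda>y. {x, y}) ` {y \<in> verts G. adj G x y}"
  proof
    show "{e \<in> edges G. x \<in> e} \<subseteq> (\<lambda>y. {x, y}) ` {y \<in> verts G. adj G x y}"
    proof clarify
      fix e assume e: "e \<in> edges G" "x \<in> e"
      then have "e \<in> [verts G]\<^bsup>2\<^esup>" using assms by (auto simp: simple_graph_def)
      then obtain y where "y \<in> verts G" "e = {x, y}"
        using e(2) unfolding nsets2_eq by blast
      then show "e \<in> (\<lambda>y. {x, y}) ` {y \<in> verts G. adj G x y}" using e by auto
    qed
  qed auto
  moreover have "inj_on (\<lambda>y. {x, y}) {y \<in> verts G. adj G x y}"
    by (auto simp: inj_on_def doubleton_eq_iff)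
  ultimately show ?thesis by (simp add: degree_def card_image)
qed

lemma tri_sum_le_triangles:
  assumes "simple_graph G"
  shows "adjacency.tri_sum (adj G) (verts G) (verts G) (verts G) \<le> 6 * real (triangles G)"
proof -
  interpret adjacency "verts G" "adj G" using assms by (rule adjacency_simple_graph)
  let ?V = "verts G"
  let ?Tr = "{(x, y, z) \<in> ?V \<times> ?V \<times> ?V. adj G x y \<and> adj G y z \<and> adj G x z}"
  have fin: "finite (triangle_sets G)"
    by (rule finite_subset[of _ "Pow ?V"]) (auto simp: triangle_sets_def finite_V)
  have "tri_sum ?V ?V ?V = (\<Sum>p\<in>?V \<times> ?V \<times> ?V. of_bool (p \<in> ?Tr))"
    unfolding tri_sum_def sum.cartesian_product by (intro sum.cong) auto
  also have "\<dots> = card (?V \<times> ?V \<times> ?V \<inter> {p. p \<in> ?Tr})"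
    using finite_V by (intro sum_of_bool_eq finite_cartesian_product)
  also have "?V \<times> ?V \<times> ?V \<inter> {p. p \<in> ?Tr} = ?Tr" by auto
  finally have S: "tri_sum ?V ?V ?V = card ?Tr" .
  have "?Tr \<subseteq> (\<Union>T\<in>triangle_sets G. {(x, y, z). {x, y, z} = T})"
  proof clarify
    fix x y z
    assume *: "x \<in> ?V" "y \<in> ?V" "z \<in> ?V" "adj G x y" "adj G y z" "adj G x z"
    then have "x \<noteq> y" "y \<noteq> z" "x \<noteq> z" using E_irrefl by auto
    moreover have "[{x, y, z}]\<^bsup>2\<^esup> \<subseteq> edges G"
      using * by (auto simp: nsets2_eq insert_commute)
    ultimately have "{x, y, z} \<in> triangle_sets G"
      using * by (simp add: triangle_sets_def)
    then show "(x, y, z) \<in> (\<Union>T\<in>triangle_sets G. {(x, y, z). {x, y, z} = T})" by blast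
  qed
  then have "card ?Tr \<le> card (\<Union>T\<in>triangle_sets G. {(x, y, z). {x, y, z} = T})"
    using fin card_ordered_triples_le
    by (intro card_mono) (auto simp: triangle_sets_def)
  also have "\<dots> \<le> (\<Sum>T\<in>triangle_sets G. card {(x, y, z). {x, y, z} = T})"
    by (rule card_UN_le[OF fin])
  also have "\<dots> \<le> (\<Sum>T\<in>triangle_sets G. 6)"
    using card_ordered_triples_le by (intro sum_mono) (auto simp: triangle_sets_def)
  finally have "card ?Tr \<le> 6 * triangles G"
    by (simp add: triangles_eq_card_triangle_sets)
  then show ?thesis unfolding S by linarith
qed

text \<open>
  With fewer than \<open>k\<^sup>2\<close> triangles, the clique \<open>low\<close> of size \<open>l\<close> satisfies
  \<open>(l - 2)\<^sup>3 \<le> 6 k\<^sup>2 \<le> (2 k\<^bsup>2/3\<^esup>)\<^sup>3\<close>. The hypothesis on \<open>k\<close> makes the resulting bound on \<open>l\<close> at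
  most \<open>k / 2\<close>.
\<close>

lemma triangles_ore_graph_ge:
  assumes "ore_graph (2 * k) G" and k: "4 + 4 * real k powr (2 / 3) \<le> real k"
  shows "real k ^ 2 - real k * real k powr (2 / 3) - 11657 * real k \<le> real (triangles G)"
proof (cases "real (triangles G) \<ge> real k ^ 2")
  case True
  moreover have "0 \<le> real k * real k powr (2 / 3)" by simp
  ultimately show ?thesis by linarith
next
  case False
  have G: "simple_graph G" "card (verts G) = 2 * k" using assms(1) by (auto simp: ore_graph_def)
  interpret adjacency "verts G" "adj G" using G(1) by (rule adjacency_simple_graph)
  have deg: "deg x = real (degree G x)" for x
    unfolding deg_def degree_eq_card_adj[OF G(1)] using finite_V by (simp add: Int_def)
  interpret ore_adjacency "verts G" "adj G" k
  proof unfold_locales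
    show "card (verts G) = 2 * k" by (rule G(2))
    fix x y assume "x \<in> verts G" "y \<in> verts G" "x \<noteq> y" "\<not> adj G x y"
    then have "2 * k + 1 \<le> degree G x + degree G y"
      using assms(1) unfolding ore_graph_def by blast
    then show "2 * real k + 1 \<le> deg x + deg y" unfolding deg by linarith
  qed
  let ?S = "tri_sum (verts G) (verts G) (verts G)"
  define l where "l = real (card low)"
  define c where "c = real k powr (2 / 3)"
  have c0: "c \<ge> 0" by (simp add: c_def)
  have k1: "k \<ge> 1" using k c0 unfolding c_def by linarith
  have c3: "c ^ 3 = real k ^ 2"
  proof -
    have "c ^ 3 = c powr 3" using k1 by (simp add: c_def powr_numeral)
    also have "\<dots> = real k ^ 2" using k1 by (simp add: c_def powr_powr powr_numeral)
    finally show ?thesis .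
  qed
  have S: "?S \<le> 6 * real (triangles G)" using G(1) by (rule tri_sum_le_triangles)
  have l: "l \<le> 2 + 2 * c"
  proof (cases "card low \<ge> 2")
    case True
    have "(l - 2) ^ 3 \<le> ?S"
      unfolding l_def using low_subset low_clique True by (rule tri_sum_clique)
    also have "\<dots> \<le> 8 * real k ^ 2"
    proof -
      have "real (triangles G) \<le> real k ^ 2" using \<open>\<not> real k ^ 2 \<le> real (triangles G)\<close> by linarith
      then show ?thesis using S zero_le_power2[of "real k"] by linarith
    qed
    also have "\<dots> = (2 * c) ^ 3" by (simp add: power_mult_distrib c3)
    finally have "l - 2 \<le> 2 * c"
      using c0 True power_mono_iff[of "l - 2" "2 * c" 3] by (simp add: l_def)
    then show ?thesis by simp
  next
    case False
    then show ?thesis using c0 by (simp add: l_def)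
  qed
  have "2 * card low \<le> k" using l k unfolding l_def c_def by linarith
  moreover have "?S \<le> 6 * real k ^ 2" using S False by linarith
  ultimately have "6 * real k ^ 2 - 3 * (l * k) - 69936 * real k \<le> ?S"
    using tri_sum_lower_bound k1 by (simp add: l_def)
  moreover have "l * k \<le> (2 + 2 * c) * k" using l by (rule mult_right_mono) simp
  moreover have "(2 + 2 * c) * k = 2 * real k + 2 * (real k * c)" by (simp add: algebra_simps)
  ultimately show ?thesis using S unfolding c_def by argo
qed

section \<open>A graph with few triangles\<close>

text \<open>
  The sides are the two parity classes, and a block \<open>{4 i, 4 i + 1, 4 i + 2, 4 i + 3}\<close> carries the two
  matching edges \<open>{4 i, 4 i + 2}\<close> and \<open>{4 i + 1, 4 i + 3}\<close>. For odd \<open>k\<close>, the last block consists of two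
  vertices only, one unmatched on each side.
\<close>

definition extremal_adj :: "nat \<Rightarrow> nat \<Rightarrow> bool" where
  "extremal_adj x y \<longleftrightarrow> x \<noteq> y \<and> (x mod 2 \<noteq> y mod 2 \<or> x div 4 = y div 4)"

definition extremal_graph :: "nat \<Rightarrow> nat graph" where
  "extremal_graph k = ({..<2 * k}, {{x, y} | x y. x < 2 * k \<and> y < 2 * k \<and> extremal_adj x y})"

lemma adj_extremal_graph:
  "adj (extremal_graph k) x y \<longleftrightarrow> x < 2 * k \<and> y < 2 * k \<and> extremal_adj x y"
  by (auto simp: extremal_graph_def doubleton_eq_iff extremal_adj_def)

lemma simple_extremal_graph: "simple_graph (extremal_graph k)"
  by (auto simp: simple_graph_def extremal_graph_def nsets_def extremal_adj_def)

lemma mod_4_cases: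
  fixes x :: nat
  obtains b r where "x = 4 * b + r" "r = 0 \<or> r = 1 \<or> r = 2 \<or> r = 3"
    "x div 4 = b" "x mod 4 = r" "x mod 2 = r mod 2"
proof -
  have "x mod 4 < 4" by simp
  then have "x mod 4 = 0 \<or> x mod 4 = 1 \<or> x mod 4 = 2 \<or> x mod 4 = 3" by linarith
  moreover have "x mod 2 = (x mod 4) mod 2" by (simp add: mod_mod_cancel)
  ultimately show ?thesis using that[of "x div 4" "x mod 4"] by simp
qed

lemma opposite_parity_eq:
  fixes x z :: nat
  assumes "z mod 2 \<noteq> x mod 2"
  shows "2 * (z div 2) + (1 - x mod 2) = z"
  using assms
  by (cases "even z"; cases "even x")
    (auto simp: odd_iff_mod_2_eq_one even_iff_mod_2_eq_zero minus_mod_eq_mult_div[symmetric])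

lemma card_opposite_parity:
  fixes x :: nat
  shows "card {y. y < 2 * k \<and> y mod 2 \<noteq> x mod 2} = k"
proof -
  have "bij_betw (\<lambda>v. 2 * v + (1 - x mod 2)) {..<k} {y. y < 2 * k \<and> y mod 2 \<noteq> x mod 2}"
    by (rule bij_betw_byWitness[where f' = "\<lambda>y. y div 2"])
      (use opposite_parity_eq in \<open>auto simp: mod_2_eq_odd split: if_splits\<close>)
  then show ?thesis using bij_betw_same_card by fastforce
qed

lemma same_block_same_parity:
  fixes x y :: nat
  assumes "x div 4 = y div 4" "x mod 2 = y mod 2" "x < y"
  shows "y = x + 2 \<and> x mod 4 < 2"
  by (rule mod_4_cases[of x]; rule mod_4_cases[of y]) (use assms in auto)

text \<open>
  Matching edges within \<open>{..<2 * k}\<close> are numbered by \<open>w < k\<close>: the edge with number \<open>w\<close> starts at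
  \<open>4 (w div 2) + w mod 2\<close>.
\<close>

lemma block_index:
  fixes x :: nat
  assumes "x mod 4 < 2" "x + 2 < 2 * k"
  defines "w \<equiv> 2 * (x div 4) + x mod 2"
  shows "4 * (w div 2) + w mod 2 = x \<and> w < k \<and> w mod 2 = x mod 2"
  unfolding w_def by (rule mod_4_cases[of x]) (use assms in auto)

text \<open>
  The second bound needs a complete block, in which \<open>x\<close> has a partner.
\<close>

lemma degree_extremal_graph:
  assumes "x < 2 * k"
  shows "degree (extremal_graph k) x \<ge> k"
    and "4 * (x div 4) + 4 \<le> 2 * k \<Longrightarrow> degree (extremal_graph k) x \<ge> k + 1"
proof -
  let ?N = "{y. y < 2 * k \<and> y mod 2 \<noteq> x mod 2}"
  have d: "degree (extremal_graph k) x = card {y. y < 2 * k \<and> extremal_adj x y}"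
    unfolding degree_eq_card_adj[OF simple_extremal_graph] adj_extremal_graph
    using assms by (intro arg_cong[of _ _ card]) (auto simp: extremal_graph_def)
  show "degree (extremal_graph k) x \<ge> k"
  proof -
    have "card ?N \<le> card {y. y < 2 * k \<and> extremal_adj x y}"
      by (intro card_mono) (auto simp: extremal_adj_def)
    then show ?thesis by (simp add: d card_opposite_parity)
  qed
  assume block: "4 * (x div 4) + 4 \<le> 2 * k"
  define y where "y = 4 * (x div 4) + (x + 2) mod 4"
  have y: "y < 2 * k" "y mod 2 = x mod 2" "y \<noteq> x" "y div 4 = x div 4"
  proof -
    have "(x + 2) mod 4 < 4" by simp
    then show "y < 2 * k" unfolding y_def using block by linarith
    show "y div 4 = x div 4" unfolding y_def by simp
    have "even y = even x" unfolding y_def by (simp add: dvd_mod_iff)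
    then show "y mod 2 = x mod 2" by (simp add: mod_2_eq_odd)
    have "(x + 2) mod 4 \<noteq> x mod 4"
    proof
      assume "(x + 2) mod 4 = x mod 4"
      then show False by (simp add: mod_eq_dvd_iff_nat)
    qed
    then show "y \<noteq> x" unfolding y_def using mult_div_mod_eq[of 4 x] by linarith
  qed
  have "card (insert y ?N) \<le> card {y. y < 2 * k \<and> extremal_adj x y}"
    using y by (intro card_mono) (auto simp: extremal_adj_def)
  moreover have "card (insert y ?N) = Suc (card ?N)"
    using y by (intro card_insert_disjoint) auto
  ultimately show "degree (extremal_graph k) x \<ge> k + 1" by (simp add: d card_opposite_parity)
qed

text \<open>
  Two distinct non-adjacent vertices have the same parity and lie in different blocks, and the
  earlier of these blocks is complete. So one of the degrees exceeds \<open>k\<close>, which is all that is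
  needed when the other vertex is the unmatched one.
\<close>

lemma ore_extremal_graph: "ore_graph (2 * k) (extremal_graph k)"
proof -
  have "2 * k + 1 \<le> degree (extremal_graph k) x + degree (extremal_graph k) y"
    if "x < 2 * k" "y < 2 * k" "x \<noteq> y" "\<not> adj (extremal_graph k) x y" for x y
    using that
  proof (induction x y rule: linorder_wlog)
    case (le x y)
    have "x div 4 \<noteq> y div 4" using le by (simp add: adj_extremal_graph extremal_adj_def)
    moreover have "x div 4 \<le> y div 4" using le by (simp add: div_le_mono)
    ultimately have "4 * (x div 4) + 4 \<le> 4 * (y div 4)" by linarith
    also have "\<dots> \<le> y" by simp
    finally have "4 * (x div 4) + 4 \<le> 2 * k" using le by linarith
    then show ?case
      using degree_extremal_graph(2)[of x k] degree_extremal_graph(1)[of y k] le by linarith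
  next
    case (sym x y)
    then show ?case by (simp add: insert_commute add.commute)
  qed
  then show ?thesis
    using simple_extremal_graph by (auto simp: ore_graph_def extremal_graph_def)
qed

text \<open>
  Two vertices of a triangle have the same parity, hence form a matching edge, which does not
  extend to a triangle within the side. So the triangle is given by the number \<open>w < k\<close> of the
  edge and the index \<open>v < k\<close> of the third vertex on the other side.
\<close>

lemma triangles_extremal_graph: "triangles (extremal_graph k) \<le> k ^ 2"
proof -
  define g where "g w = 4 * (w div 2) + w mod 2" for w :: nat
  define h where "h = (\<lambda>(w, v). {g w, g w + 2, 2 * v + (1 - w mod 2)})"
  have "triangle_sets (extremal_graph k) \<subseteq> h ` ({..<k} \<times> {..<k})"
  proof
    fix T assume T: "T \<in> triangle_sets (extremal_graph k)"
    then have "card T = 3" by (simp add: triangle_sets_def)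
    then obtain p q r where pqr: "T = {p, q, r}" "p \<noteq> q" "p \<noteq> r" "q \<noteq> r"
      unfolding card_3_iff by blast
    have adj: "x < 2 * k \<and> y < 2 * k \<and> extremal_adj x y" if "x \<in> T" "y \<in> T" "x \<noteq> y" for x y
    proof -
      have "{x, y} \<in> [T]\<^bsup>2\<^esup>" using that unfolding nsets2_eq by blast
      then show ?thesis using T adj_extremal_graph unfolding triangle_sets_def by blast
    qed
    have "\<exists>x y z. T = {x, y, z} \<and> x < y \<and> x \<noteq> z \<and> y \<noteq> z \<and> x mod 2 = y mod 2"
    proof -
      have main: "\<exists>x y z. T = {x, y, z} \<and> x < y \<and> x \<noteq> z \<and> y \<noteq> z \<and> x mod 2 = y mod 2"
        if "T = {u, v, w}" "u \<noteq> v" "u \<noteq> w" "v \<noteq> w" "u mod 2 = v mod 2" for u v w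
      proof (cases "u < v")
        case True
        then show ?thesis using that by blast
      next
        case False
        then have "T = {v, u, w}" "v < u" using that by auto
        then show ?thesis using that(2-5) by (intro exI[of _ v] exI[of _ u] exI[of _ w]) auto
      qed
      have "p mod 2 = q mod 2 \<or> p mod 2 = r mod 2 \<or> q mod 2 = r mod 2"
        by (auto simp: mod_2_eq_odd)
      then show ?thesis
      proof (elim disjE)
        assume "p mod 2 = q mod 2"
        then show ?thesis using main[OF pqr] by simp
      next
        assume "p mod 2 = r mod 2"
        then show ?thesis using main[of p r q] pqr by (simp add: insert_commute)
      next
        assume "q mod 2 = r mod 2"
        then show ?thesis using main[of q r p] pqr by (simp add: insert_commute)
      qed
    qed
    then obtain x y z where xyz: "T = {x, y, z}" "x < y" "x \<noteq> z" "y \<noteq> z" "x mod 2 = y mod 2"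
      by blast
    have xy: "y < 2 * k" "x div 4 = y div 4"
      using adj[of x y] xyz by (auto simp: extremal_adj_def)
    then have y: "y = x + 2" "x mod 4 < 2" using same_block_same_parity xyz(2,5) by auto
    have z: "z < 2 * k" "z mod 2 \<noteq> x mod 2"
    proof -
      show "z < 2 * k" using adj[of x z] xyz by simp
      show "z mod 2 \<noteq> x mod 2"
      proof
        assume eq: "z mod 2 = x mod 2"
        then have block: "z div 4 = x div 4"
          using adj[of x z] xyz by (auto simp: extremal_adj_def)
        show False
        proof (cases "x < z")
          case True
          then show False using same_block_same_parity[of x z] block eq y xyz(4) by simp
        next
          case False
          then have "x = z + 2" using same_block_same_parity[of z x] block eq xyz(3) by simp
          moreover have "y = z + 2"
          proof -
            have "z div 4 = y div 4" "z mod 2 = y mod 2" "z < y"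
              using block xy(2) eq xyz(2,5) False by linarith+
            then show ?thesis using same_block_same_parity by blast
          qed
          ultimately show False using xyz(2) by linarith
        qed
      qed
    qed
    define w where "w = 2 * (x div 4) + x mod 2"
    have w: "g w = x" "w < k" "w mod 2 = x mod 2"
      unfolding w_def g_def using block_index[of x k] y xy(1) by simp_all
    have "2 * (z div 2) + (1 - x mod 2) = z" "z div 2 < k"
      using z opposite_parity_eq by auto
    then have "T = h (w, z div 2)" by (simp add: h_def w xyz(1) y(1))
    with w \<open>z div 2 < k\<close> show "T \<in> h ` ({..<k} \<times> {..<k})" by blast
  qed
  then have "card (triangle_sets (extremal_graph k)) \<le> card ({..<k} \<times> {..<k})"
    by (intro surj_card_le) auto
  then show ?thesis by (simp add: triangles_eq_card_triangle_sets power2_eq_square)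
qed

section \<open>The limit\<close>

theorem theorem10:
  shows "(\<lambda>k. real (t3_min (2 * k)) / (real (2 * k))\<^sup>2) \<longlonglongrightarrow> 1 / 4"
proof (rule tendsto_sandwich)
  define f where "f = (\<lambda>k::nat. (real k ^ 2 - real k * real k powr (2 / 3) - 11657 * real k) / (real (2 * k))\<^sup>2)"
  have ev: "\<forall>\<^sub>F k in sequentially. 4 + 4 * real k powr (2 / 3) \<le> real k"
    by real_asymp
  show "\<forall>\<^sub>F k in sequentially. f k \<le> real (t3_min (2 * k)) / (real (2 * k))\<^sup>2"
    using ev
  proof eventually_elim
    case (elim k)
    obtain G :: "nat graph" where "ore_graph (2 * k) G" "triangles G = t3_min (2 * k)"
      using t3_min_attained by blast
    then show ?case
      unfolding f_def using triangles_ore_graph_ge[of k G] elim by (intro divide_right_mono) auto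
  qed
  show "f \<longlonglongrightarrow> 1 / 4" unfolding f_def by real_asymp
  show "\<forall>\<^sub>F k in sequentially. real (t3_min (2 * k)) / (real (2 * k))\<^sup>2 \<le> 1 / 4"
  proof (rule always_eventually, rule allI)
    fix k
    have "t3_min (2 * k) \<le> k ^ 2"
      using t3_min_le[OF ore_extremal_graph] triangles_extremal_graph order_trans by blast
    then have "real (t3_min (2 * k)) \<le> real k ^ 2" by (metis of_nat_le_iff of_nat_power)
    then show "real (t3_min (2 * k)) / (real (2 * k))\<^sup>2 \<le> 1 / 4"
      by (cases "k = 0") (simp_all add: field_simps)
  qed
qed (rule tendsto_const)

end
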